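(* Suppose $\alpha\le\frac{2\delta}{\mu}<\beta$ and $M\le M_0\left(\frac{2\delta}{\mu}\right)$. Consider the HJB equation $$0=\max_{\alpha\le a\le\beta}\left(\tfrac12\sigma^2a^2V''(x)+(a\mu-\delta)V'(x)-\gamma V(x)+M(1-V'(x))^+\right),\qquad V(0)=0,\qquad(\ast)$$ on $[0,\infty)$ together with the bounds $0\le V(x)\le\frac{M}{\gamma}$ for all $x>0$ $(\ast\ast)$. (i) If $\alpha<\frac{2\delta}{\mu}$ and $\alpha\le\tilde c$, then $$V(x)=\frac{M}{\gamma}\left(1-\exp\left(-\frac{\mu}{\sigma^2\tilde c}x\right)\right),\qquad x\ge0,$$ is a concave, twice continuously differentiable solution of $(\ast)$ satisfying $(\ast\ast)$. (ii) If $\alpha=\frac{2\delta}{\mu}$ or $\tilde c<\alpha$, then $$V(x)=\frac{M}{\gamma}\left(1-e^{\tilde r_-(\alpha)x}\right),\qquad x\ge0,$$ is a concave, twice continuously differentiable solution of $(\ast)$ satisfying $(\ast\ast)$.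
   Context: Parameters: real constants $\mu>0$, $\sigma>0$, $\gamma>0$, $\delta\ge0$, $M>0$, $0<\alpha<\beta<\infty$; $y^+=\max(y,0)$. $\tilde c=\dfrac{2\mu(\delta+M)}{\mu^2+2\gamma\sigma^2}$, $\quad\tilde r_-(\alpha)=\dfrac{-(\alpha\mu-\delta-M)-\sqrt{(\alpha\mu-\delta-M)^2+2\gamma\sigma^2\alpha^2}}{\sigma^2\alpha^2}$. $M_0(z)=\dfrac{z^2\sigma^2\gamma}{2(z\mu-\delta)}$ for $z>\delta/\mu$, so $M_0\left(\frac{2\delta}{\mu}\right)=\dfrac{2\delta\sigma^2\gamma}{\mu^2}$. *)

theory Defs
  imports "HOL-Analysis.Analysis"
begin

text \<open>Functions on \<open>[0,\<infinity>)\<close> are total functions \<open>real \<Rightarrow> real\<close> of which only the values on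
  \<open>{0..}\<close> are used. Derivatives are taken within \<open>{0..}\<close>: two-sided for \<open>x > 0\<close>
  and one-sided (from the right) at \<open>0\<close>.\<close>

definition halfline_deriv :: "(real \<Rightarrow> real) \<Rightarrow> real \<Rightarrow> real" where
  "halfline_deriv f x = vector_derivative f (at x within {0..})"

definition C2_halfline :: "(real \<Rightarrow> real) \<Rightarrow> bool" where
  "C2_halfline f \<longleftrightarrow>
     f differentiable_on {0..} \<and>
     halfline_deriv f differentiable_on {0..} \<and>
     continuous_on {0..} (halfline_deriv (halfline_deriv f))"

definition c_tilde :: "real \<Rightarrow> real \<Rightarrow> real \<Rightarrow> real \<Rightarrow> real \<Rightarrow> real" where
  "c_tilde \<mu> \<sigma> \<gamma> \<delta> M = 2 * \<mu> * (\<delta> + M) / (\<mu>\<^sup>2 + 2 * \<gamma> * \<sigma>\<^sup>2)"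

definition r_tilde_minus :: "real \<Rightarrow> real \<Rightarrow> real \<Rightarrow> real \<Rightarrow> real \<Rightarrow> real \<Rightarrow> real" where
  "r_tilde_minus \<mu> \<sigma> \<gamma> \<delta> M \<alpha> =
     (- (\<alpha> * \<mu> - \<delta> - M) - sqrt ((\<alpha> * \<mu> - \<delta> - M)\<^sup>2 + 2 * \<gamma> * \<sigma>\<^sup>2 * \<alpha>\<^sup>2)) / (\<sigma>\<^sup>2 * \<alpha>\<^sup>2)"

text \<open>Meaningful for \<open>z > \<delta> / \<mu>\<close>.\<close>

definition M0 :: "real \<Rightarrow> real \<Rightarrow> real \<Rightarrow> real \<Rightarrow> real \<Rightarrow> real" where
  "M0 \<mu> \<sigma> \<gamma> \<delta> z = z\<^sup>2 * \<sigma>\<^sup>2 * \<gamma> / (2 * (z * \<mu> - \<delta>))"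

definition hjb_expr ::
  "real \<Rightarrow> real \<Rightarrow> real \<Rightarrow> real \<Rightarrow> real \<Rightarrow> (real \<Rightarrow> real) \<Rightarrow> real \<Rightarrow> real \<Rightarrow> real" where
  "hjb_expr \<mu> \<sigma> \<gamma> \<delta> M V x a =
     1 / 2 * \<sigma>\<^sup>2 * a\<^sup>2 * halfline_deriv (halfline_deriv V) x
     + (a * \<mu> - \<delta>) * halfline_deriv V x - \<gamma> * V x
     + M * max (1 - halfline_deriv V x) 0"

text \<open>The maximum over \<open>a\<close> is an attained one: it exists and its value is \<open>0\<close>.\<close>

definition hjb_solution ::
  "real \<Rightarrow> real \<Rightarrow> real \<Rightarrow> real \<Rightarrow> real \<Rightarrow> real \<Rightarrow> real \<Rightarrow> (real \<Rightarrow> real) \<Rightarrow> bool" where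
  "hjb_solution \<mu> \<sigma> \<gamma> \<delta> M \<alpha> \<beta> V \<longleftrightarrow>
     (\<forall>x\<ge>0. \<exists>a. is_arg_max (hjb_expr \<mu> \<sigma> \<gamma> \<delta> M V x) (\<lambda>a. \<alpha> \<le> a \<and> a \<le> \<beta>) a
                \<and> hjb_expr \<mu> \<sigma> \<gamma> \<delta> M V x a = 0)
     \<and> V 0 = 0"

end

theory Submission
  imports Defs
begin

text \<open>Both candidates are of the form \<open>V x = M / \<gamma> * (1 - exp (- k * x))\<close> with \<open>k > 0\<close>.
  For such a \<open>V\<close> one has \<open>V' \<le> 1\<close> on the half-line exactly when \<open>M * k \<le> \<gamma>\<close>, because \<open>V'\<close>
  decreases from \<open>V' 0 = M * k / \<gamma>\<close>. Then the positive part in the equation is \<open>1 - V'\<close>, the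
  constant terms cancel, and the expression to be maximised factors as
  \<open>M / \<gamma> * exp (- k * x) * q a\<close>, where
  \<open>q a = - \<sigma>\<^sup>2 k\<^sup>2 a\<^sup>2 / 2 + \<mu> k a - (\<delta> + M) k + \<gamma>\<close> does not involve \<open>x\<close>. So \<open>V\<close> solves the
  equation as soon as the maximum of \<open>q\<close> over \<open>{\<alpha>..\<beta>}\<close> is \<open>0\<close> (lemma
  \<open>exp_profile_hjb_solution\<close>), and it remains to look at a concave parabola with vertex
  \<open>\<mu> / (\<sigma>\<^sup>2 k)\<close>.

  If the vertex is admissible, \<open>q\<close> must vanish there. This is a linear equation for \<open>k\<close>; its
  solution is \<open>\<mu> / (\<sigma>\<^sup>2 c)\<close> with \<open>c\<close> the constant \<open>c_tilde\<close>, and the vertex is then \<open>c\<close> itself.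
  If the vertex lies to the left of \<open>\<alpha>\<close>, the maximum is at \<open>\<alpha>\<close>, and \<open>q \<alpha> = 0\<close> is a quadratic
  equation for \<open>k\<close> with the positive root \<open>- r_tilde_minus\<close>.

  The bound on \<open>M\<close> unfolds to \<open>M * \<mu>\<^sup>2 \<le> 2 * \<delta> * \<sigma>\<^sup>2 * \<gamma>\<close> and enters twice. It is equivalent to
  \<open>c \<le> 2 * \<delta> / \<mu>\<close> (lemma \<open>c_tilde_le_iff\<close>). Hence \<open>c \<le> \<beta>\<close> in the first case and \<open>c \<le> \<alpha>\<close> in
  the second, where the latter means that the vertex is not to the right of \<open>\<alpha>\<close> (lemma
  \<open>vertex_le_of_c_tilde_le\<close>). It also gives \<open>M * k \<le> \<gamma>\<close> (lemma \<open>exp_profile_slope_le_1\<close>): as a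
  function of \<open>k > 0\<close>, with \<open>a\<close> fixed, \<open>q\<close> is positive exactly to the left of its positive zero, and
  at \<open>k = \<gamma> / M\<close> it is nonpositive for every \<open>a\<close>.\<close>

section \<open>Exponential profiles on the half-line\<close>

text \<open>Derivatives within the half-line see only the values there, and they are unique because
  \<open>{0..}\<close> has no isolated point, not even \<open>0\<close>.\<close>

lemma halfline_deriv_eqI:
  assumes "(g has_vector_derivative d) (at x)" and "\<And>y. y \<ge> 0 \<Longrightarrow> f y = g y" and "x \<ge> 0"
  shows "(f has_vector_derivative d) (at x within {0..})" and "halfline_deriv f x = d"
proof -
  have "(g has_vector_derivative d) (at x within {0..})"
    using assms(1) by (rule has_vector_derivative_at_within)
  then show *: "(f has_vector_derivative d) (at x within {0..})"
    using assms(2,3) by (intro has_vector_derivative_transform[of x "{0..}" f g]) auto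
  have "infinite {0::real..}"
    by (rule infinite_Ici)
  then have "{0::real..} \<noteq> {z}" for z
    by (metis finite.emptyI finite.insertI)
  then have "x islimpt {0..}"
    using assms(3) by (intro connected_imp_perfect) simp_all
  then have "at x within {0..} \<noteq> bot"
    by (simp add: trivial_limit_within)
  then show "halfline_deriv f x = d"
    unfolding halfline_deriv_def using * by (rule vector_derivative_within)
qed

lemma exp_profile_derivs:
  fixes L k :: real
  assumes V: "\<And>x. x \<ge> 0 \<Longrightarrow> V x = L * (1 - exp (- k * x))" and "x \<ge> 0"
  shows "halfline_deriv V x = L * k * exp (- k * x)"
    and "halfline_deriv (halfline_deriv V) x = - (L * k\<^sup>2 * exp (- k * x))"
    and "V differentiable (at x within {0..})"
    and "halfline_deriv V differentiable (at x within {0..})"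
proof -
  have d1: "((\<lambda>x. L * (1 - exp (- k * x))) has_vector_derivative L * k * exp (- k * x)) (at x)" for x
    by (auto intro!: derivative_eq_intros simp: has_real_derivative_iff_has_vector_derivative[symmetric])
  have d2: "((\<lambda>x. L * k * exp (- k * x)) has_vector_derivative - (L * k\<^sup>2 * exp (- k * x))) (at x)" for x
    by (auto intro!: derivative_eq_intros
        simp: has_real_derivative_iff_has_vector_derivative[symmetric] power2_eq_square)
  have 1: "halfline_deriv V x = L * k * exp (- k * x)" if "x \<ge> 0" for x
    using halfline_deriv_eqI(2)[OF d1 V that] by simp
  show "halfline_deriv V x = L * k * exp (- k * x)"
    using 1 assms(2) .
  show "halfline_deriv (halfline_deriv V) x = - (L * k\<^sup>2 * exp (- k * x))"
    using halfline_deriv_eqI(2)[OF d2 1 assms(2)] .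
  show "V differentiable (at x within {0..})"
    using halfline_deriv_eqI(1)[OF d1 V assms(2)] by (rule differentiableI_vector)
  show "halfline_deriv V differentiable (at x within {0..})"
    using halfline_deriv_eqI(1)[OF d2 1 assms(2)] by (rule differentiableI_vector)
qed

lemma exp_profile_C2_halfline:
  fixes L k :: real
  assumes V: "\<And>x. x \<ge> 0 \<Longrightarrow> V x = L * (1 - exp (- k * x))"
  shows "C2_halfline V"
proof -
  have "continuous_on {0..} (\<lambda>x. - (L * k\<^sup>2 * exp (- k * x)))"
    by (intro continuous_intros)
  then have "continuous_on {0..} (halfline_deriv (halfline_deriv V))"
    using exp_profile_derivs(2)[OF V] by (subst continuous_on_cong[OF refl]) auto
  then show ?thesis
    unfolding C2_halfline_def differentiable_on_def
    using exp_profile_derivs(3,4)[OF V] by auto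
qed

lemma exp_profile_concave:
  fixes L k :: real
  assumes V: "\<And>x. x \<ge> 0 \<Longrightarrow> V x = L * (1 - exp (- k * x))" and "L \<ge> 0"
  shows "concave_on {0..} V"
proof -
  have "concave_on {0..} (\<lambda>x. L * (1 - exp (- k * x)))"
    by (rule f''_le0_imp_concave[where f' = "\<lambda>x. L * k * exp (- k * x)"
          and f'' = "\<lambda>x. - (L * k\<^sup>2 * exp (- k * x))"])
      (use \<open>L \<ge> 0\<close> in \<open>auto intro!: derivative_eq_intros simp: power2_eq_square\<close>)
  then show ?thesis
    unfolding concave_on_iff using V by auto
qed

lemma exp_profile_bounds:
  fixes L k x :: real
  assumes "V x = L * (1 - exp (- k * x))" and "L \<ge> 0" and "k \<ge> 0" and "x \<ge> 0"
  shows "0 \<le> V x \<and> V x \<le> L"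
  using assms by (auto intro!: mult_left_le)

section \<open>Reduction of the equation to a parabola\<close>

text \<open>\<open>- hjb_parabola\<close>, read as a polynomial in \<open>k\<close>, is the characteristic polynomial at \<open>- k\<close> of
  the linear equation with constant control \<open>a\<close> and dividends paid at the full rate \<open>M\<close>.\<close>

definition hjb_parabola :: "real \<Rightarrow> real \<Rightarrow> real \<Rightarrow> real \<Rightarrow> real \<Rightarrow> real \<Rightarrow> real \<Rightarrow> real" where
  "hjb_parabola \<mu> \<sigma> \<gamma> \<delta> M k a =
     - (\<sigma>\<^sup>2 * k\<^sup>2 * a\<^sup>2 / 2) + \<mu> * k * a - (\<delta> + M) * k + \<gamma>"

text \<open>Since \<open>V' \<le> V' 0 = M * k / \<gamma> \<le> 1\<close>, the positive part can be dropped; its constant \<open>M\<close> cancels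
  the constant in \<open>- \<gamma> * V\<close>, so that every remaining term carries the exponential.\<close>

lemma hjb_expr_exp_profile:
  fixes \<mu> \<sigma> \<gamma> \<delta> M k :: real
  assumes V: "\<And>x. x \<ge> 0 \<Longrightarrow> V x = M / \<gamma> * (1 - exp (- k * x))"
    and "\<gamma> > 0" "M > 0" "k \<ge> 0" "M * k \<le> \<gamma>" "x \<ge> 0"
  shows "hjb_expr \<mu> \<sigma> \<gamma> \<delta> M V x a = M / \<gamma> * exp (- k * x) * hjb_parabola \<mu> \<sigma> \<gamma> \<delta> M k a"
proof -
  have "exp (- k * x) \<le> 1"
    using assms by simp
  moreover have "0 \<le> M / \<gamma> * k" "M / \<gamma> * k \<le> 1"
    using assms by (auto simp: field_simps)
  ultimately have "M / \<gamma> * k * exp (- k * x) \<le> 1"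
    by (meson mult_le_one exp_ge_zero)
  then have "max (1 - M / \<gamma> * k * exp (- k * x)) 0 = 1 - M / \<gamma> * k * exp (- k * x)"
    by simp
  moreover have "halfline_deriv V x = M / \<gamma> * k * exp (- k * x)"
    and "halfline_deriv (halfline_deriv V) x = - (M / \<gamma> * k\<^sup>2 * exp (- k * x))"
    using exp_profile_derivs(1,2) V \<open>x \<ge> 0\<close> by blast+
  ultimately have "hjb_expr \<mu> \<sigma> \<gamma> \<delta> M V x a
      = 1 / 2 * \<sigma>\<^sup>2 * a\<^sup>2 * - (M / \<gamma> * k\<^sup>2 * exp (- k * x))
        + (a * \<mu> - \<delta>) * (M / \<gamma> * k * exp (- k * x)) - \<gamma> * (M / \<gamma> * (1 - exp (- k * x)))
        + M * (1 - M / \<gamma> * k * exp (- k * x))"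
    unfolding hjb_expr_def by (simp only: V[OF \<open>x \<ge> 0\<close>])
  also have "\<dots> = M / \<gamma> * exp (- k * x) * hjb_parabola \<mu> \<sigma> \<gamma> \<delta> M k a"
    unfolding hjb_parabola_def using \<open>\<gamma> > 0\<close> by (simp add: field_simps power2_eq_square)
  finally show ?thesis .
qed

lemma exp_profile_hjb_solution:
  fixes \<mu> \<sigma> \<gamma> \<delta> M k :: real
  assumes V: "\<And>x. x \<ge> 0 \<Longrightarrow> V x = M / \<gamma> * (1 - exp (- k * x))"
    and "\<gamma> > 0" "M > 0" "k \<ge> 0" "M * k \<le> \<gamma>"
    and "\<alpha> \<le> b" "b \<le> \<beta>"
    and root: "hjb_parabola \<mu> \<sigma> \<gamma> \<delta> M k b = 0"
    and nonpos: "\<And>a. \<alpha> \<le> a \<Longrightarrow> a \<le> \<beta> \<Longrightarrow> hjb_parabola \<mu> \<sigma> \<gamma> \<delta> M k a \<le> 0"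
  shows "hjb_solution \<mu> \<sigma> \<gamma> \<delta> M \<alpha> \<beta> V"
proof -
  have expr: "hjb_expr \<mu> \<sigma> \<gamma> \<delta> M V x a
      = M / \<gamma> * exp (- k * x) * hjb_parabola \<mu> \<sigma> \<gamma> \<delta> M k a" if "x \<ge> 0" for x a
    using hjb_expr_exp_profile[OF V] assms that by blast
  have "hjb_expr \<mu> \<sigma> \<gamma> \<delta> M V x b = 0" if "x \<ge> 0" for x
    using expr[OF that] root by simp
  moreover have "hjb_expr \<mu> \<sigma> \<gamma> \<delta> M V x a \<le> 0" if "x \<ge> 0" "\<alpha> \<le> a" "a \<le> \<beta>" for x a
    unfolding expr[OF that(1)] using nonpos[OF that(2,3)] \<open>\<gamma> > 0\<close> \<open>M > 0\<close>
    by (intro mult_nonneg_nonpos) auto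
  ultimately show ?thesis
    unfolding hjb_solution_def is_arg_max_def
    using V[of 0] \<open>\<alpha> \<le> b\<close> \<open>b \<le> \<beta>\<close> by (fastforce simp: not_less)
qed

lemma exp_profile_concave_C2_solution:
  fixes \<mu> \<sigma> \<gamma> \<delta> M k :: real
  assumes "\<And>x. x \<ge> 0 \<Longrightarrow> V x = M / \<gamma> * (1 - exp (- k * x))"
    and "\<gamma> > 0" "M > 0" "k \<ge> 0" "M * k \<le> \<gamma>"
    and "\<alpha> \<le> b" "b \<le> \<beta>"
    and "hjb_parabola \<mu> \<sigma> \<gamma> \<delta> M k b = 0"
    and "\<And>a. \<alpha> \<le> a \<Longrightarrow> a \<le> \<beta> \<Longrightarrow> hjb_parabola \<mu> \<sigma> \<gamma> \<delta> M k a \<le> 0"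
  shows "concave_on {0..} V \<and> C2_halfline V \<and> hjb_solution \<mu> \<sigma> \<gamma> \<delta> M \<alpha> \<beta> V \<and>
    (\<forall>x>0. 0 \<le> V x \<and> V x \<le> M / \<gamma>)"
proof (intro conjI)
  have "M / \<gamma> \<ge> 0"
    using assms(2,3) by simp
  then show "concave_on {0..} V" and "\<forall>x>0. 0 \<le> V x \<and> V x \<le> M / \<gamma>"
    using exp_profile_concave[OF assms(1)] exp_profile_bounds assms(1) \<open>k \<ge> 0\<close>
    by (blast, metis less_imp_le)
  show "C2_halfline V"
    using exp_profile_C2_halfline[OF assms(1)] .
  show "hjb_solution \<mu> \<sigma> \<gamma> \<delta> M \<alpha> \<beta> V"
    using exp_profile_hjb_solution[OF assms] .
qed

section \<open>The vertex and the roots of the parabola\<close>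

text \<open>Second-order expansion at \<open>b\<close>: exact because \<open>hjb_parabola\<close> is quadratic in the control.\<close>

lemma hjb_parabola_expand:
  "hjb_parabola \<mu> \<sigma> \<gamma> \<delta> M k a =
     hjb_parabola \<mu> \<sigma> \<gamma> \<delta> M k b + k * (\<mu> - \<sigma>\<^sup>2 * k * b) * (a - b) - \<sigma>\<^sup>2 * k\<^sup>2 / 2 * (a - b)\<^sup>2"
  unfolding hjb_parabola_def by (simp add: field_simps power2_eq_square)

text \<open>A concave function stays below its tangent. At \<open>b\<close> the tangent has slope
  \<open>k * (\<mu> - \<sigma>\<^sup>2 * k * b)\<close>, so the third hypothesis says that it is horizontal, or that it
  does not rise and \<open>a\<close> lies to the right of \<open>b\<close>.\<close>

lemma hjb_parabola_nonpos:
  assumes "hjb_parabola \<mu> \<sigma> \<gamma> \<delta> M k b = 0" and "k \<ge> 0"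
    and "\<mu> = \<sigma>\<^sup>2 * k * b \<or> \<mu> \<le> \<sigma>\<^sup>2 * k * b \<and> b \<le> a"
  shows "hjb_parabola \<mu> \<sigma> \<gamma> \<delta> M k a \<le> 0"
proof -
  have "(\<mu> - \<sigma>\<^sup>2 * k * b) * (a - b) \<le> 0"
    using assms(3) by (auto simp: mult_le_0_iff)
  then have "k * ((\<mu> - \<sigma>\<^sup>2 * k * b) * (a - b)) \<le> 0"
    using assms(2) by (rule mult_nonneg_nonpos[rotated])
  moreover have "\<sigma>\<^sup>2 * k\<^sup>2 / 2 * (a - b)\<^sup>2 \<ge> 0"
    by simp
  ultimately show ?thesis
    unfolding hjb_parabola_expand[of _ _ _ _ _ _ a b] using assms(1)
    by (simp only: mult.assoc)
qed

text \<open>With \<open>k = \<mu> / (\<sigma>\<^sup>2 * c)\<close> the value at the vertex \<open>c\<close> is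
  \<open>\<mu>\<^sup>2 / (2 * \<sigma>\<^sup>2) + \<gamma> - (\<delta> + M) * k\<close>, and \<open>c_tilde\<close> is the \<open>c\<close> that makes it zero.\<close>

lemma hjb_parabola_c_tilde:
  fixes \<mu> \<sigma> \<gamma> \<delta> M :: real
  defines "c \<equiv> c_tilde \<mu> \<sigma> \<gamma> \<delta> M"
  assumes "\<mu> > 0" "\<sigma> > 0" "\<gamma> > 0" "\<delta> \<ge> 0" "M > 0"
  shows "hjb_parabola \<mu> \<sigma> \<gamma> \<delta> M (\<mu> / (\<sigma>\<^sup>2 * c)) c = 0"
proof -
  have pos: "\<mu>\<^sup>2 + 2 * \<gamma> * \<sigma>\<^sup>2 > 0" "\<delta> + M > 0"
    using assms by (auto intro: add_pos_pos)
  have "c > 0"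
    unfolding c_def c_tilde_def using assms pos by simp
  define k where "k = \<mu> / (\<sigma>\<^sup>2 * c)"
  have vertex: "\<sigma>\<^sup>2 * k * c = \<mu>"
    unfolding k_def using \<open>c > 0\<close> \<open>\<sigma> > 0\<close> by simp
  have "c * (\<mu>\<^sup>2 + 2 * \<gamma> * \<sigma>\<^sup>2) = 2 * \<mu> * (\<delta> + M)"
    unfolding c_def c_tilde_def using pos by simp
  then have "\<sigma>\<^sup>2 * k * c * (\<mu>\<^sup>2 + 2 * \<gamma> * \<sigma>\<^sup>2) = \<sigma>\<^sup>2 * k * (2 * \<mu> * (\<delta> + M))"
    by (simp only: mult.assoc)
  then have "\<mu> * (\<mu>\<^sup>2 + 2 * \<gamma> * \<sigma>\<^sup>2) = \<mu> * (2 * \<sigma>\<^sup>2 * k * (\<delta> + M))"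
    unfolding vertex by (simp only: mult_ac)
  then have "\<mu>\<^sup>2 + 2 * \<gamma> * \<sigma>\<^sup>2 = 2 * \<sigma>\<^sup>2 * k * (\<delta> + M)"
    using \<open>\<mu> > 0\<close> by simp
  moreover have "2 * \<sigma>\<^sup>2 * hjb_parabola \<mu> \<sigma> \<gamma> \<delta> M k c
      = - (\<sigma>\<^sup>2 * k * c)\<^sup>2 + 2 * \<mu> * (\<sigma>\<^sup>2 * k * c) - 2 * \<sigma>\<^sup>2 * k * (\<delta> + M) + 2 * \<gamma> * \<sigma>\<^sup>2"
    unfolding hjb_parabola_def by (simp add: power2_eq_square algebra_simps)
  ultimately have "2 * \<sigma>\<^sup>2 * hjb_parabola \<mu> \<sigma> \<gamma> \<delta> M k c = 0"
    unfolding vertex by (simp add: power2_eq_square)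
  then show ?thesis
    unfolding k_def using \<open>\<sigma> > 0\<close> by simp
qed

text \<open>With \<open>A = \<sigma>\<^sup>2 * \<alpha>\<^sup>2\<close> and \<open>B = \<alpha> * \<mu> - \<delta> - M\<close> the equation for \<open>k\<close> reads
  \<open>A * k\<^sup>2 / 2 - B * k - \<gamma> = 0\<close>, that is \<open>(A * k - B)\<^sup>2 = B\<^sup>2 + 2 * \<gamma> * A\<close> after completing the
  square. Its right-hand side exceeds \<open>B\<^sup>2\<close>, which gives the sign of the root.\<close>

lemma r_tilde_minus_root:
  fixes \<mu> \<sigma> \<gamma> \<delta> M \<alpha> :: real
  defines "k \<equiv> - r_tilde_minus \<mu> \<sigma> \<gamma> \<delta> M \<alpha>"
  assumes "\<sigma> > 0" "\<gamma> > 0" "\<alpha> > 0"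
  shows "k > 0" and "hjb_parabola \<mu> \<sigma> \<gamma> \<delta> M k \<alpha> = 0"
proof -
  define B where "B = \<alpha> * \<mu> - \<delta> - M"
  define A where "A = \<sigma>\<^sup>2 * \<alpha>\<^sup>2"
  define D where "D = B\<^sup>2 + 2 * \<gamma> * \<sigma>\<^sup>2 * \<alpha>\<^sup>2"
  have "A > 0"
    unfolding A_def using assms by simp
  have D: "D = B\<^sup>2 + 2 * \<gamma> * A"
    unfolding D_def A_def by simp
  have k: "k = (B + sqrt D) / A"
    unfolding k_def r_tilde_minus_def B_def A_def D_def
    by (simp add: add_divide_distrib diff_divide_distrib)
  have "B\<^sup>2 < D"
    unfolding D using \<open>A > 0\<close> assms by simp
  then have "\<bar>B\<bar> < sqrt D"
    by (metis real_sqrt_abs real_sqrt_less_mono)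
  then show "k > 0"
    unfolding k using \<open>A > 0\<close> by simp
  have "(sqrt D)\<^sup>2 = D"
    using \<open>B\<^sup>2 < D\<close> by (smt (verit) real_sqrt_pow2 zero_le_power2)
  moreover have "sqrt D = A * k - B"
    unfolding k using \<open>A > 0\<close> by simp
  ultimately have "(A * k - B)\<^sup>2 = B\<^sup>2 + 2 * \<gamma> * A"
    using D by metis
  then have "A * (A * k\<^sup>2 / 2 - B * k - \<gamma>) = 0"
    by (simp add: power2_eq_square algebra_simps)
  then have "A * k\<^sup>2 / 2 - B * k - \<gamma> = 0"
    using \<open>A > 0\<close> by simp
  then show "hjb_parabola \<mu> \<sigma> \<gamma> \<delta> M k \<alpha> = 0"
    unfolding hjb_parabola_def A_def B_def by (simp add: algebra_simps)
qed

text \<open>In the variable \<open>k\<close> the function \<open>hjb_parabola\<close> is concave with the positive value \<open>\<gamma>\<close> at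
  \<open>0\<close>, so that its sign at \<open>l > 0\<close> tells on which side of the positive zero \<open>k\<close> the point \<open>l\<close>
  lies. The proof makes this explicit: writing \<open>q k\<close> for the value at rate \<open>k\<close>, one has
  \<open>l * q k - k * q l = (l - k) * (\<gamma> + \<sigma>\<^sup>2 * a\<^sup>2 * k * l / 2)\<close>.\<close>

lemma hjb_parabola_rate_compare:
  assumes "\<gamma> > 0" "k > 0" "l > 0" and "hjb_parabola \<mu> \<sigma> \<gamma> \<delta> M k a = 0"
  shows "hjb_parabola \<mu> \<sigma> \<gamma> \<delta> M l a \<ge> 0 \<longleftrightarrow> l \<le> k"
    and "hjb_parabola \<mu> \<sigma> \<gamma> \<delta> M l a \<le> 0 \<longleftrightarrow> k \<le> l"
proof -
  have "l * hjb_parabola \<mu> \<sigma> \<gamma> \<delta> M k a - k * hjb_parabola \<mu> \<sigma> \<gamma> \<delta> M l a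
      = (l - k) * (\<gamma> + \<sigma>\<^sup>2 * a\<^sup>2 * k * l / 2)"
    unfolding hjb_parabola_def by (simp add: power2_eq_square field_simps)
  then have eq: "k * hjb_parabola \<mu> \<sigma> \<gamma> \<delta> M l a = (k - l) * (\<gamma> + \<sigma>\<^sup>2 * a\<^sup>2 * k * l / 2)"
    using assms(4) by (simp add: left_diff_distrib)
  have "\<gamma> + \<sigma>\<^sup>2 * a\<^sup>2 * k * l / 2 > 0"
    using assms by (intro add_pos_nonneg) auto
  then show "hjb_parabola \<mu> \<sigma> \<gamma> \<delta> M l a \<ge> 0 \<longleftrightarrow> l \<le> k"
    and "hjb_parabola \<mu> \<sigma> \<gamma> \<delta> M l a \<le> 0 \<longleftrightarrow> k \<le> l"
    using \<open>k > 0\<close> arg_cong[OF eq, of "\<lambda>t. 0 \<le> t"] arg_cong[OF eq, of "\<lambda>t. t \<le> 0"]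
    by (simp_all add: zero_le_mult_iff mult_le_0_iff)
qed

text \<open>The value at \<open>k = \<gamma> / M\<close>, the largest rate for which \<open>V' 0 \<le> 1\<close>, is \<open>- \<gamma> / M\<close> times
  \<open>\<sigma>\<^sup>2 * \<gamma> * a\<^sup>2 / (2 * M) - \<mu> * a + \<delta>\<close>. The bound on \<open>M\<close> says precisely that the discriminant
  of this quadratic in \<open>a\<close> is nonpositive.\<close>

lemma hjb_parabola_critical_rate:
  assumes "M > 0" "\<gamma> > 0" "\<delta> > 0" and "M * \<mu>\<^sup>2 \<le> 2 * \<delta> * \<sigma>\<^sup>2 * \<gamma>"
  shows "hjb_parabola \<mu> \<sigma> \<gamma> \<delta> M (\<gamma> / M) a \<le> 0"
proof -
  \<comment> \<open>In the borderline case \<open>M * \<mu>\<^sup>2 = 2 * \<delta> * \<sigma>\<^sup>2 * \<gamma>\<close> the quadratic has the double zero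
    \<open>2 * \<delta> / \<mu>\<close>, which suggests this square.\<close>
  have "M * (a * \<mu> - 2 * \<delta>)\<^sup>2 \<ge> 0"
    using assms by simp
  moreover have "M * \<mu>\<^sup>2 * a\<^sup>2 \<le> 2 * \<delta> * \<sigma>\<^sup>2 * \<gamma> * a\<^sup>2"
    using assms by (intro mult_right_mono) auto
  ultimately have "0 \<le> 2 * \<delta> * (\<sigma>\<^sup>2 * \<gamma> * a\<^sup>2 - 2 * M * \<mu> * a + 2 * M * \<delta>)"
    by (simp add: power2_eq_square algebra_simps)
  then have "0 \<le> \<sigma>\<^sup>2 * \<gamma> * a\<^sup>2 - 2 * M * \<mu> * a + 2 * M * \<delta>"
    using assms by (simp add: zero_le_mult_iff)
  moreover have "hjb_parabola \<mu> \<sigma> \<gamma> \<delta> M (\<gamma> / M) a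
      = - (\<gamma> / (2 * M\<^sup>2)) * (\<sigma>\<^sup>2 * \<gamma> * a\<^sup>2 - 2 * M * \<mu> * a + 2 * M * \<delta>)"
    unfolding hjb_parabola_def using assms by (simp add: power2_eq_square field_simps)
  ultimately show ?thesis
    using assms by (simp add: mult_nonpos_nonneg)
qed

text \<open>The conclusion says that \<open>V' 0 \<le> 1\<close> for the profile with rate \<open>k\<close>.\<close>

lemma exp_profile_slope_le_1:
  assumes "M > 0" "\<gamma> > 0" "\<delta> > 0" "M * \<mu>\<^sup>2 \<le> 2 * \<delta> * \<sigma>\<^sup>2 * \<gamma>"
    and "k > 0" "hjb_parabola \<mu> \<sigma> \<gamma> \<delta> M k a = 0"
  shows "M * k \<le> \<gamma>"
proof -
  have "hjb_parabola \<mu> \<sigma> \<gamma> \<delta> M (\<gamma> / M) a \<le> 0"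
    using assms by (intro hjb_parabola_critical_rate)
  then have "k \<le> \<gamma> / M"
    using hjb_parabola_rate_compare(2)[of \<gamma> k "\<gamma> / M"] assms by simp
  then show ?thesis
    using assms by (simp add: field_simps)
qed

lemma M_le_M0_iff:
  assumes "\<mu> > 0" "\<delta> > 0"
  shows "M \<le> M0 \<mu> \<sigma> \<gamma> \<delta> (2 * \<delta> / \<mu>) \<longleftrightarrow> M * \<mu>\<^sup>2 \<le> 2 * \<delta> * \<sigma>\<^sup>2 * \<gamma>"
proof -
  have "M0 \<mu> \<sigma> \<gamma> \<delta> (2 * \<delta> / \<mu>) = 2 * \<delta> * \<sigma>\<^sup>2 * \<gamma> / \<mu>\<^sup>2"
    unfolding M0_def using assms by (simp add: field_simps power2_eq_square)
  then show ?thesis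
    using assms by (simp add: pos_le_divide_eq)
qed

lemma c_tilde_le_iff:
  assumes "\<mu> > 0" "\<sigma> > 0" "\<gamma> > 0"
  shows "c_tilde \<mu> \<sigma> \<gamma> \<delta> M \<le> 2 * \<delta> / \<mu> \<longleftrightarrow> M * \<mu>\<^sup>2 \<le> 2 * \<delta> * \<sigma>\<^sup>2 * \<gamma>"
proof -
  have "\<mu>\<^sup>2 + 2 * \<gamma> * \<sigma>\<^sup>2 > 0"
    using assms by (auto intro: add_pos_pos)
  then have "c_tilde \<mu> \<sigma> \<gamma> \<delta> M \<le> 2 * \<delta> / \<mu> \<longleftrightarrow>
      2 * \<mu> * (\<delta> + M) * \<mu> \<le> 2 * \<delta> * (\<mu>\<^sup>2 + 2 * \<gamma> * \<sigma>\<^sup>2)"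
    unfolding c_tilde_def using assms by (simp add: divide_le_eq le_divide_eq mult.commute)
  then show ?thesis
    by (simp add: algebra_simps power2_eq_square)
qed

text \<open>With \<open>l = \<mu> / (\<sigma>\<^sup>2 * \<alpha>)\<close> the vertex is \<open>\<alpha>\<close>, and there the parabola is nonnegative once
  \<open>c_tilde \<le> \<alpha>\<close>. Hence \<open>l \<le> k\<close> for the rate \<open>k\<close> with zero \<open>\<alpha>\<close>, and the vertex for \<open>k\<close> is at
  most \<open>\<alpha>\<close>.\<close>

lemma vertex_le_of_c_tilde_le:
  assumes "\<mu> > 0" "\<sigma> > 0" "\<gamma> > 0" "\<alpha> > 0" "k > 0"
    and "hjb_parabola \<mu> \<sigma> \<gamma> \<delta> M k \<alpha> = 0" and "c_tilde \<mu> \<sigma> \<gamma> \<delta> M \<le> \<alpha>"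
  shows "\<mu> \<le> \<sigma>\<^sup>2 * k * \<alpha>"
proof -
  define l where "l = \<mu> / (\<sigma>\<^sup>2 * \<alpha>)"
  have "l > 0"
    unfolding l_def using assms by simp
  have "\<mu>\<^sup>2 + 2 * \<gamma> * \<sigma>\<^sup>2 > 0"
    using assms by (auto intro: add_pos_pos)
  then have "2 * \<mu> * (\<delta> + M) \<le> \<alpha> * (\<mu>\<^sup>2 + 2 * \<gamma> * \<sigma>\<^sup>2)"
    using assms(7) unfolding c_tilde_def by (simp add: divide_le_eq)
  moreover have "hjb_parabola \<mu> \<sigma> \<gamma> \<delta> M l \<alpha>
      = (\<alpha> * (\<mu>\<^sup>2 + 2 * \<gamma> * \<sigma>\<^sup>2) - 2 * \<mu> * (\<delta> + M)) / (2 * \<sigma>\<^sup>2 * \<alpha>)"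
    unfolding hjb_parabola_def l_def using \<open>\<sigma> > 0\<close> \<open>\<alpha> > 0\<close>
    by (simp add: field_simps power2_eq_square)
  ultimately have "hjb_parabola \<mu> \<sigma> \<gamma> \<delta> M l \<alpha> \<ge> 0"
    using assms by simp
  then have "l \<le> k"
    using hjb_parabola_rate_compare(1) assms \<open>l > 0\<close> by blast
  then show ?thesis
    unfolding l_def using assms by (simp add: field_simps)
qed

section \<open>The two explicit solutions\<close>

theorem theorem3p16:
  fixes \<mu> \<sigma> \<gamma> \<delta> M \<alpha> \<beta> :: real
  assumes "\<mu> > 0" and "\<sigma> > 0" and "\<gamma> > 0" and "\<delta> \<ge> 0" and "M > 0"
    and "0 < \<alpha>" and "\<alpha> < \<beta>"
    and "\<alpha> \<le> 2 * \<delta> / \<mu>" and "2 * \<delta> / \<mu> < \<beta>"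
    and "M \<le> M0 \<mu> \<sigma> \<gamma> \<delta> (2 * \<delta> / \<mu>)"
  shows
    "(\<alpha> < 2 * \<delta> / \<mu> \<and> \<alpha> \<le> c_tilde \<mu> \<sigma> \<gamma> \<delta> M \<longrightarrow>
       (\<forall>V :: real \<Rightarrow> real.
          (\<forall>x\<ge>0. V x = M / \<gamma> * (1 - exp (- (\<mu> / (\<sigma>\<^sup>2 * c_tilde \<mu> \<sigma> \<gamma> \<delta> M)) * x))) \<longrightarrow>
          concave_on {0..} V \<and> C2_halfline V \<and> hjb_solution \<mu> \<sigma> \<gamma> \<delta> M \<alpha> \<beta> V \<and>
          (\<forall>x>0. 0 \<le> V x \<and> V x \<le> M / \<gamma>)))
     \<and>
     (\<alpha> = 2 * \<delta> / \<mu> \<or> c_tilde \<mu> \<sigma> \<gamma> \<delta> M < \<alpha> \<longrightarrow>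
       (\<forall>V :: real \<Rightarrow> real.
          (\<forall>x\<ge>0. V x = M / \<gamma> * (1 - exp (r_tilde_minus \<mu> \<sigma> \<gamma> \<delta> M \<alpha> * x))) \<longrightarrow>
          concave_on {0..} V \<and> C2_halfline V \<and> hjb_solution \<mu> \<sigma> \<gamma> \<delta> M \<alpha> \<beta> V \<and>
          (\<forall>x>0. 0 \<le> V x \<and> V x \<le> M / \<gamma>)))"
proof -
  define c where "c = c_tilde \<mu> \<sigma> \<gamma> \<delta> M"
  have "2 * \<delta> / \<mu> > 0"
    using assms by simp
  then have "\<delta> > 0"
    using assms by (simp add: zero_less_divide_iff)
  have M: "M * \<mu>\<^sup>2 \<le> 2 * \<delta> * \<sigma>\<^sup>2 * \<gamma>"
    using M_le_M0_iff assms \<open>\<delta> > 0\<close> by blast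
  have c_le: "c \<le> 2 * \<delta> / \<mu>"
    unfolding c_def using c_tilde_le_iff assms M by blast
  show ?thesis
    unfolding c_def[symmetric]
  proof (intro conjI[of "_ \<longrightarrow> _" "_ \<longrightarrow> _"] impI allI)
    fix V :: "real \<Rightarrow> real"
    assume c: "\<alpha> < 2 * \<delta> / \<mu> \<and> \<alpha> \<le> c"
      and V: "\<forall>x\<ge>0. V x = M / \<gamma> * (1 - exp (- (\<mu> / (\<sigma>\<^sup>2 * c)) * x))"
    define k where "k = \<mu> / (\<sigma>\<^sup>2 * c)"
    have "c > 0" "c \<le> \<beta>"
      using c c_le assms by auto
    have "k > 0"
      unfolding k_def using \<open>c > 0\<close> assms by simp
    have root: "hjb_parabola \<mu> \<sigma> \<gamma> \<delta> M k c = 0"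
      unfolding k_def c_def using assms by (intro hjb_parabola_c_tilde)
    have "\<mu> = \<sigma>\<^sup>2 * k * c"
      unfolding k_def using \<open>c > 0\<close> assms by simp
    then have "hjb_parabola \<mu> \<sigma> \<gamma> \<delta> M k a \<le> 0" for a
      using hjb_parabola_nonpos root \<open>k > 0\<close> by (metis less_imp_le)
    moreover have "M * k \<le> \<gamma>"
      using exp_profile_slope_le_1 assms \<open>\<delta> > 0\<close> M \<open>k > 0\<close> root by blast
    moreover have "V x = M / \<gamma> * (1 - exp (- k * x))" if "x \<ge> 0" for x
      using V that unfolding k_def by simp
    ultimately show "concave_on {0..} V \<and> C2_halfline V \<and> hjb_solution \<mu> \<sigma> \<gamma> \<delta> M \<alpha> \<beta> V \<and>
        (\<forall>x>0. 0 \<le> V x \<and> V x \<le> M / \<gamma>)"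
      using assms c \<open>c \<le> \<beta>\<close> \<open>k > 0\<close> root
      by (intro exp_profile_concave_C2_solution[where k = k and b = c]) auto
  next
    fix V :: "real \<Rightarrow> real"
    assume c: "\<alpha> = 2 * \<delta> / \<mu> \<or> c < \<alpha>"
      and V: "\<forall>x\<ge>0. V x = M / \<gamma> * (1 - exp (r_tilde_minus \<mu> \<sigma> \<gamma> \<delta> M \<alpha> * x))"
    define k where "k = - r_tilde_minus \<mu> \<sigma> \<gamma> \<delta> M \<alpha>"
    have "k > 0" and root: "hjb_parabola \<mu> \<sigma> \<gamma> \<delta> M k \<alpha> = 0"
      unfolding k_def using r_tilde_minus_root assms by blast+
    have "c \<le> \<alpha>"
      using c c_le by auto
    then have "\<mu> \<le> \<sigma>\<^sup>2 * k * \<alpha>"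
      unfolding c_def using vertex_le_of_c_tilde_le assms \<open>k > 0\<close> root by blast
    then have "hjb_parabola \<mu> \<sigma> \<gamma> \<delta> M k a \<le> 0" if "\<alpha> \<le> a" for a
      using hjb_parabola_nonpos root \<open>k > 0\<close> that by (metis less_imp_le)
    moreover have "M * k \<le> \<gamma>"
      using exp_profile_slope_le_1 assms \<open>\<delta> > 0\<close> M \<open>k > 0\<close> root by blast
    moreover have "V x = M / \<gamma> * (1 - exp (- k * x))" if "x \<ge> 0" for x
      using V that unfolding k_def by simp
    ultimately show "concave_on {0..} V \<and> C2_halfline V \<and> hjb_solution \<mu> \<sigma> \<gamma> \<delta> M \<alpha> \<beta> V \<and>
        (\<forall>x>0. 0 \<le> V x \<and> V x \<le> M / \<gamma>)"
      using assms \<open>k > 0\<close> root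
      by (intro exp_profile_concave_C2_solution[where k = k and b = \<alpha>]) auto
  qed
qed

end
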